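(* Let $G$ be a finite simple connected walk-regular graph, and let $u,v$ (with $u\ne v$) and $w,z$ (with $w\neq z$) be pairs of vertices of $G$ such that $u\sim v$ if and only if $w\sim z$. Then the following statements are equivalent: (a) $\operatorname{sp}(G\pm uv)=\operatorname{sp}(G\pm wz)$. (b) $\operatorname{sp} G_{u+v}=\operatorname{sp} G_{w+z}$. (c) $\operatorname{sp}(G+u\bar u v)=\operatorname{sp}(G+w\bar w z)$.
   Context: $u\sim v$ means that $u$ and $v$ are adjacent. $\operatorname{sp}$ denotes the spectrum (eigenvalues with multiplicities) of the adjacency matrix of a graph or pseudograph (a graph possibly with loops and multiple edges). A graph with adjacency matrix $A=(a_{xy})$ is walk-regular if for every $\ell\ge 0$ the number $(A^\ell)_{uu}$ does not depend on the vertex $u$. For distinct vertices $u,v$: - $G\pm uv$ is the graph obtained from $G$ by flipping $uv$: the edge $uv$ is deleted if $u\sim v$, and added if $u\not\sim v$. - $G_{u+v}$ is the pseudograph obtained from $G$ by amalgamating $u$ and $v$ into a single new vertex $u+v$: the adjacencies among the other vertices are unchanged, the entry of the adjacency matrix for $u+v$ and another vertex $x$ is $a_{ux}+a_{vx}$ (so common neighbors produce multiple edges), and the diagonal entry at $u+v$ is $a_{uv}$ (so if $u\sim v$ the edge $uv$ becomes a loop, contributing $1$). - $G+u\bar u v$ is the graph obtained from $G$ by adding a new vertex $\bar u$ adjacent exactly to $u$ and $v$. *)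

theory Defs
  imports
    Complex_Main
    "Graph_Theory.Digraph_Component"
    "Jordan_Normal_Form.Char_Poly"
begin

text \<open>
  Finite simple graphs are \<open>pair_graph\<close>s: an edge \<open>xy\<close> is the pair of arcs \<open>(x, y)\<close>, \<open>(y, x)\<close>.
  A pseudograph is given by its vertex set and the entries of its adjacency matrix; an undirected
  loop at \<open>x\<close> contributes 1 to \<open>mult x x\<close>.
\<close>

record 'a pseudograph =
  psverts :: "'a set"
  mult :: "'a \<Rightarrow> 'a \<Rightarrow> nat"

definition adj_entry :: "'a pair_pre_digraph \<Rightarrow> 'a \<Rightarrow> 'a \<Rightarrow> nat" where
  "adj_entry G x y = (if (x, y) \<in> parcs G then 1 else 0)"

definition pseudograph_of :: "'a pair_pre_digraph \<Rightarrow> 'a pseudograph" where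
  "pseudograph_of G = \<lparr>psverts = pverts G, mult = adj_entry G\<rparr>"

text \<open>
  The adjacency matrix is taken with respect to an arbitrary but fixed enumeration of the (finite)
  vertex set. A different enumeration conjugates the matrix by a permutation matrix, so that
  neither the spectrum nor walk-regularity depends on the choice.
\<close>

definition vertex_enum :: "'a set \<Rightarrow> 'a list" where
  "vertex_enum V = (SOME xs. distinct xs \<and> set xs = V)"

lemma vertex_enum:
  assumes "finite V"
  shows "distinct (vertex_enum V)" and "set (vertex_enum V) = V"
proof -
  have "\<exists>xs. distinct xs \<and> set xs = V"
    using finite_distinct_list[OF assms] by blast
  then have "distinct (vertex_enum V) \<and> set (vertex_enum V) = V"
    unfolding vertex_enum_def by (rule someI_ex)
  then show "distinct (vertex_enum V)" and "set (vertex_enum V) = V"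
    by blast+
qed

definition adj_mat :: "'a pseudograph \<Rightarrow> complex mat" where
  "adj_mat H = (let xs = vertex_enum (psverts H) in
     mat (length xs) (length xs) (\<lambda>(i, j). of_nat (mult H (xs ! i) (xs ! j))))"

text \<open>
  The multiset of complex eigenvalues with algebraic multiplicities; for the symmetric matrices at
  hand these are real and the algebraic multiplicities are the geometric ones.
\<close>

definition sp :: "'a pseudograph \<Rightarrow> complex multiset" where
  "sp H = proots (char_poly (adj_mat H))"

definition walk_regular :: "'a pair_pre_digraph \<Rightarrow> bool" where
  "walk_regular G \<longleftrightarrow> (let A = adj_mat (pseudograph_of G) in
     \<forall>l::nat. \<forall>i<dim_row A. \<forall>j<dim_row A. (A ^\<^sub>m l) $$ (i, i) = (A ^\<^sub>m l) $$ (j, j))"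

definition flip_edge :: "'a pair_pre_digraph \<Rightarrow> 'a \<Rightarrow> 'a \<Rightarrow> 'a pair_pre_digraph" where
  "flip_edge G u v = \<lparr>pverts = pverts G,
     parcs = (if (u, v) \<in> parcs G then parcs G - {(u, v), (v, u)}
              else parcs G \<union> {(u, v), (v, u)})\<rparr>"

text \<open>
  In the next two constructions \<open>None\<close> is the new vertex: the amalgamated one, and the one
  adjacent to \<open>u\<close> and \<open>v\<close>, respectively.
\<close>

fun amalg_mult :: "'a pair_pre_digraph \<Rightarrow> 'a \<Rightarrow> 'a \<Rightarrow> 'a option \<Rightarrow> 'a option \<Rightarrow> nat" where
  "amalg_mult G u v None None = adj_entry G u v"
| "amalg_mult G u v None (Some x) = adj_entry G u x + adj_entry G v x"
| "amalg_mult G u v (Some x) None = adj_entry G u x + adj_entry G v x"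
| "amalg_mult G u v (Some x) (Some y) = adj_entry G x y"

definition amalgamate :: "'a pair_pre_digraph \<Rightarrow> 'a \<Rightarrow> 'a \<Rightarrow> 'a option pseudograph" where
  "amalgamate G u v = \<lparr>psverts = insert None (Some ` (pverts G - {u, v})),
     mult = amalg_mult G u v\<rparr>"

definition add_common_neighbor ::
  "'a pair_pre_digraph \<Rightarrow> 'a \<Rightarrow> 'a \<Rightarrow> 'a option pair_pre_digraph" where
  "add_common_neighbor G u v = \<lparr>pverts = insert None (Some ` pverts G),
     parcs = {(Some x, Some y) | x y. (x, y) \<in> parcs G} \<union>
       {(None, Some u), (Some u, None), (None, Some v), (Some v, None)}\<rparr>"

end

theory Submission
  imports Defs
begin

text \<open>
  For a pair \<open>u, v\<close> let \<open>\<phi>\<close>, \<open>D\<close>, \<open>E\<close> be the characteristic polynomials of \<open>G\<close>, \<open>G - u\<close> and \<open>G - u - v\<close>.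
  Walk-regularity makes \<open>D\<close> independent of \<open>u\<close>, because the adjugate of \<open>x I - A\<close> is a polynomial in
  \<open>A\<close>. Eliminating all vertices but \<open>u\<close>, \<open>v\<close> (and the new one) by a Schur complement expresses the
  three characteristic polynomials through \<open>\<phi>\<close>, \<open>D\<close>, \<open>E\<close> and one further polynomial \<open>T\<close> (the
  cofactor at \<open>u, v\<close>, up to sign) with \<open>E \<phi> = D\<^sup>2 - T\<^sup>2\<close>: they are \<open>\<phi> \<plusminus> 2 T - E\<close>,
  \<open>2 D - 2 T - (x - a) E\<close> and \<open>x \<phi> - 2 D - 2 T\<close>, where \<open>a = 1\<close> if \<open>u \<sim> v\<close> and \<open>a = 0\<close> otherwise. Each
  of the three cospectrality statements is therefore equivalent to \<open>T = T'\<close>: in the first two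
  cases the difference of the two sides, multiplied by \<open>\<phi>\<close>, is divisible by \<open>T - T'\<close>, and the
  complementary factor cannot vanish for degree reasons, as \<open>deg T \<le> n - 2\<close>.
\<close>

section \<open>Matrices indexed by vertex lists\<close>

definition enum_mat :: "('a \<Rightarrow> 'a \<Rightarrow> 'b) \<Rightarrow> 'a list \<Rightarrow> 'b mat" where
  "enum_mat f xs = mat (length xs) (length xs) (\<lambda>(i, j). f (xs ! i) (xs ! j))"

lemma enum_mat_carrier [simp]: "enum_mat f xs \<in> carrier_mat (length xs) (length xs)"
  and enum_mat_dim [simp]: "dim_row (enum_mat f xs) = length xs" "dim_col (enum_mat f xs) = length xs"
  and enum_mat_index [simp]:
    "i < length xs \<Longrightarrow> j < length xs \<Longrightarrow> enum_mat f xs $$ (i, j) = f (xs ! i) (xs ! j)"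
  by (simp_all add: enum_mat_def)

lemma enum_mat_cong:
  "(\<And>x y. x \<in> set xs \<Longrightarrow> y \<in> set xs \<Longrightarrow> f x y = g x y) \<Longrightarrow> enum_mat f xs = enum_mat g xs"
  by (intro eq_matI) auto

lemma enum_mat_map: "enum_mat f (map h xs) = enum_mat (\<lambda>x y. f (h x) (h y)) xs"
  by (intro eq_matI) auto

lemma sum_nth_delta:
  fixes g :: "'a \<Rightarrow> 'b :: comm_ring_1"
  assumes "distinct ys" and "x \<in> set ys"
  shows "(\<Sum>k<length ys. (if x = ys ! k then 1 else 0) * g (ys ! k)) = g x"
    and "(\<Sum>k<length ys. g (ys ! k) * (if ys ! k = x then 1 else 0)) = g x"
proof -
  have "(\<Sum>k<length ys. if x = ys ! k then g x else 0) = (\<Sum>y\<in>set ys. if x = y then g x else 0)"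
    using sum.reindex_bij_betw[OF bij_betw_nth[OF assms(1) refl refl]] by fast
  also have "\<dots> = g x"
    using assms(2) by simp
  finally have *: "(\<Sum>k<length ys. if x = ys ! k then g x else 0) = g x" .
  then show "(\<Sum>k<length ys. (if x = ys ! k then 1 else 0) * g (ys ! k)) = g x"
    by (elim trans[rotated]) (intro sum.cong, auto)
  from * show "(\<Sum>k<length ys. g (ys ! k) * (if ys ! k = x then 1 else 0)) = g x"
    by (elim trans[rotated]) (intro sum.cong, auto)
qed

text \<open>The 0/1 matrix \<open>perm xs ys\<close> that matches positions of equal entries is a
  permutation matrix with inverse \<open>perm ys xs\<close>; conjugating by it reorders rows and
  columns simultaneously.\<close>

lemma similar_enum_mat:
  fixes f :: "'a \<Rightarrow> 'a \<Rightarrow> 'b :: comm_ring_1"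
  assumes xs: "distinct xs" and ys: "distinct ys" and eq: "set xs = set ys"
  shows "similar_mat (enum_mat f xs) (enum_mat f ys)"
proof -
  define n where "n = length xs"
  have len: "length xs = n" "length ys = n"
    using distinct_card[OF xs] distinct_card[OF ys] eq by (auto simp: n_def)
  define perm :: "'a list \<Rightarrow> 'a list \<Rightarrow> 'b mat"
    where "perm xs ys = mat n n (\<lambda>(i, j). if xs ! i = ys ! j then 1 else 0)" for xs ys
  have perm_carrier [simp]: "perm xs ys \<in> carrier_mat n n" for xs ys
    by (simp add: perm_def)
  have inv: "perm xs ys * perm ys xs = 1\<^sub>m n"
    if "distinct xs" "distinct ys" "set xs = set ys" "length xs = n" "length ys = n" for xs ys
  proof (rule eq_matI)
    fix i j assume ij: "i < dim_row (1\<^sub>m n)" "j < dim_col (1\<^sub>m n)"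
    then have "xs ! i \<in> set ys"
      using that by (metis index_one_mat(2) nth_mem)
    from sum_nth_delta(1)[OF that(2) this, of "\<lambda>y. if y = xs ! j then 1 else 0"] ij that
    show "(perm xs ys * perm ys xs) $$ (i, j) = 1\<^sub>m n $$ (i, j)"
      by (simp add: perm_def scalar_prod_def atLeast0LessThan nth_eq_iff_index_eq)
  qed (simp_all add: perm_def)
  have left: "(perm xs ys * enum_mat f ys) $$ (i, k) = f (xs ! i) (ys ! k)"
    if "i < n" "k < n" for i k
    using that sum_nth_delta(1)[OF ys, of "xs ! i" "\<lambda>y. f y (ys ! k)"] eq nth_mem[of i xs]
    by (simp add: perm_def scalar_prod_def atLeast0LessThan len)
  have "enum_mat f xs = perm xs ys * enum_mat f ys * perm ys xs"
  proof (rule eq_matI)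
    fix i j
    assume "i < dim_row (perm xs ys * enum_mat f ys * perm ys xs)"
      "j < dim_col (perm xs ys * enum_mat f ys * perm ys xs)"
    then have ij: "i < n" "j < n"
      by (simp_all add: perm_def)
    have "(perm xs ys * enum_mat f ys * perm ys xs) $$ (i, j) =
        (\<Sum>k<n. (perm xs ys * enum_mat f ys) $$ (i, k) * perm ys xs $$ (k, j))"
      using ij by (simp add: scalar_prod_def atLeast0LessThan perm_def len)
    also have "\<dots> = (\<Sum>k<length ys. f (xs ! i) (ys ! k) * (if ys ! k = xs ! j then 1 else 0))"
      using ij by (intro sum.cong) (auto simp: left len simp del: index_mult_mat, simp_all add: perm_def)
    also have "\<dots> = f (xs ! i) (xs ! j)"
      using sum_nth_delta(2)[OF ys, of "xs ! j" "f (xs ! i)"] eq nth_mem[of j xs] ij len by simp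
    finally show "enum_mat f xs $$ (i, j) = (perm xs ys * enum_mat f ys * perm ys xs) $$ (i, j)"
      using ij len by simp
  qed (simp_all add: len perm_def)
  moreover have "enum_mat f xs \<in> carrier_mat n n" "enum_mat f ys \<in> carrier_mat n n"
    using enum_mat_carrier[of f xs] enum_mat_carrier[of f ys] by (simp_all only: len)
  ultimately show ?thesis
    by (intro similar_matI[OF _ inv[OF xs ys eq len] inv[OF ys xs eq[symmetric] len(2,1)]]) simp_all
qed

text \<open>Frees later computations from the choice made in \<open>vertex_enum\<close>: the
  vertices may be listed so that the special ones come first and form a block.\<close>

lemma char_poly_adj_mat_conv_enum_mat:
  assumes "distinct xs" and "psverts H = set xs"
  shows "char_poly (adj_mat H) = char_poly (enum_mat (\<lambda>x y. of_nat (mult H x y)) xs)"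
proof -
  have "adj_mat H = enum_mat (\<lambda>x y. of_nat (mult H x y)) (vertex_enum (set xs))"
    by (simp add: adj_mat_def enum_mat_def assms(2) Let_def)
  then show ?thesis
    using char_poly_similar[OF similar_enum_mat[OF assms(1) vertex_enum(1)]] vertex_enum(2)
    by (metis List.finite_set)
qed

text \<open>Evaluating at a scalar \<open>t\<close> replaces a determinant over polynomials by one
  over a field, where blocks can be inverted.\<close>

lemma poly_char_poly_enum_mat:
  fixes f :: "'a \<Rightarrow> 'a \<Rightarrow> 'b :: field"
  assumes "distinct xs"
  shows "poly (char_poly (enum_mat f xs)) t =
    det (enum_mat (\<lambda>x y. (if x = y then t else 0) - f x y) xs)"
proof -
  have "enum_mat (\<lambda>x y. (if x = y then t else 0) - f x y) xs = - char_matrix (enum_mat f xs) t"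
    using assms by (intro eq_matI) (auto simp: char_matrix_def nth_eq_iff_index_eq)
  then show ?thesis
    by (simp add: char_poly_matrix[OF enum_mat_carrier])
qed

section \<open>Principal minors of matrices whose powers have constant diagonal\<close>

lemma mat_delete_enum_mat:
  assumes "i < length xs"
  shows "mat_delete (enum_mat f xs) i i = enum_mat f (take i xs @ drop (Suc i) xs)"
  using assms by (intro eq_matI) (auto simp: mat_delete_def nth_append)

text \<open>
  Comparing coefficients in \<open>adj (x I - A) (x I - A) = det (x I - A) I\<close> gives a downward recursion for
  the coefficient matrices \<open>C k\<close> of the adjugate, so all \<open>C k A\<^sup>l\<close> have constant diagonal.
\<close>
lemma char_poly_mat_delete_cong:
  fixes A :: "'a :: comm_ring_1 mat"
  assumes A: "A \<in> carrier_mat n n"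
    and diag: "\<And>l i j. i < n \<Longrightarrow> j < n \<Longrightarrow> (A ^\<^sub>m l) $$ (i, i) = (A ^\<^sub>m l) $$ (j, j)"
    and i: "i < n" and j: "j < n"
  shows "char_poly (mat_delete A i i) = char_poly (mat_delete A j j)"
proof -
  define M where "M = char_poly_matrix A"
  define B where "B = Determinant.adj_mat M"
  define C where "C k = mat n n (\<lambda>(i, j). coeff (B $$ (i, j)) k)" for k
  have M: "M \<in> carrier_mat n n"
    using A by (simp add: M_def)
  have B: "B \<in> carrier_mat n n" "B * M = det M \<cdot>\<^sub>m 1\<^sub>m n"
    using adj_mat[OF M] by (simp_all add: B_def)
  have C: "C k \<in> carrier_mat n n" for k
    by (simp add: C_def)
  have Crec: "C k = C (Suc k) * A + coeff (det M) (Suc k) \<cdot>\<^sub>m 1\<^sub>m n" for k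
  proof (rule eq_matI)
    fix i j
    assume "i < dim_row (C (Suc k) * A + coeff (det M) (Suc k) \<cdot>\<^sub>m 1\<^sub>m n)"
      "j < dim_col (C (Suc k) * A + coeff (det M) (Suc k) \<cdot>\<^sub>m 1\<^sub>m n)"
    then have ij: "i < n" "j < n" by auto
    have "(\<Sum>m<n. B $$ (i, m) * ((if m = j then [:0, 1:] else 0) - [:A $$ (m, j):])) = (B * M) $$ (i, j)"
      using ij B(1) M A
      by (auto simp: M_def char_poly_matrix_def scalar_prod_def atLeast0LessThan intro!: sum.cong)
    also have "\<dots> = (if i = j then det M else 0)"
      using ij by (simp add: B(2))
    finally have "(\<Sum>m<n. B $$ (i, m) * (if m = j then [:0, 1:] else 0)) =
        (\<Sum>m<n. B $$ (i, m) * [:A $$ (m, j):]) + (if i = j then det M else 0)"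
      by (simp add: algebra_simps sum_subtractf)
    also have "(\<Sum>m<n. B $$ (i, m) * (if m = j then [:0, 1:] else 0)) =
        (\<Sum>m<n. if m = j then pCons 0 (B $$ (i, j)) else 0)"
      by (intro sum.cong) (auto)
    also have "\<dots> = pCons 0 (B $$ (i, j))"
      using ij by simp
    finally have "coeff (pCons 0 (B $$ (i, j))) (Suc k) =
        coeff ((\<Sum>m<n. B $$ (i, m) * [:A $$ (m, j):]) + (if i = j then det M else 0)) (Suc k)"
      by simp
    then show "C k $$ (i, j) = (C (Suc k) * A + coeff (det M) (Suc k) \<cdot>\<^sub>m 1\<^sub>m n) $$ (i, j)"
      using ij A by (simp add: C_def coeff_sum scalar_prod_def atLeast0LessThan mult.commute)
  qed (use C A in \<open>auto simp: C_def\<close>)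
  obtain K where K: "C k = 0\<^sub>m n n" if "k \<ge> K" for k
  proof -
    define K where "K = Suc (Max ((\<lambda>(i, j). degree (B $$ (i, j))) ` ({..<n} \<times> {..<n})))"
    have "degree (B $$ (i, j)) < K" if "i < n" "j < n" for i j
      unfolding K_def less_Suc_eq_le using that by (intro Max_ge) (auto intro!: image_eqI[of _ _ "(i, j)"])
    then have "C k = 0\<^sub>m n n" if "k \<ge> K" for k
      using that by (intro eq_matI) (auto simp: C_def intro!: coeff_eq_0 dest: less_le_trans)
    then show ?thesis by (rule that)
  qed
  have pow: "A ^\<^sub>m l \<in> carrier_mat n n" for l
    using A by simp
  have pow_Suc: "A * A ^\<^sub>m l = A ^\<^sub>m Suc l" for l
    using A by (induction l) (simp_all add: assoc_mult_mat[OF A pow A, symmetric])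
  \<comment> \<open>Downward induction from \<open>K\<close>, where the coefficient matrices vanish.
    The exponent \<open>l\<close> stays arbitrary because \<open>Crec\<close> trades
    \<open>C k\<close> for \<open>C (Suc k)\<close> at the price of one more factor
    \<open>A\<close>.\<close>
  have const: "(C k * A ^\<^sub>m l) $$ (a, a) = (C k * A ^\<^sub>m l) $$ (b, b)" if "k \<le> K" "a < n" "b < n" for k l a b
    using that(1)
  proof (induction k arbitrary: l rule: inc_induct)
    case base
    show ?case using that A by (simp add: K)
  next
    case (step k)
    have "C k * A ^\<^sub>m l = C (Suc k) * A ^\<^sub>m Suc l + coeff (det M) (Suc k) \<cdot>\<^sub>m A ^\<^sub>m l"
      using C[of "Suc k"] A pow[of l]
      by (subst Crec, subst add_mult_distrib_mat[of _ n n _ _ n])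
        (auto simp: assoc_mult_mat[OF C A pow] pow_Suc mult_smult_assoc_mat[of _ n n _ n]
          simp del: pow_mat.simps)
    then show ?case
      using step.IH[of "Suc l"] diag[OF that(2,3), of l] that A by (simp del: pow_mat.simps)
  qed
  have "coeff (B $$ (i, i)) k = coeff (B $$ (j, j)) k" for k
  proof (cases "k \<le> K")
    case True
    from const[OF this i j, of 0] show ?thesis
      using i j A C[of k] by (simp add: C_def)
  next
    case False
    then have "C k $$ (i, i) = C k $$ (j, j)"
      using K[of k] i j by simp
    then show ?thesis
      using i j by (simp add: C_def)
  qed
  then have "B $$ (i, i) = B $$ (j, j)"
    by (simp add: poly_eq_iff)
  \<comment> \<open>A diagonal cofactor has sign +1, so the diagonal of the adjugate consists of the
    principal minors of \<open>x I - A\<close>.\<close>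
  moreover have "B $$ (a, a) = char_poly (mat_delete A a a)" if "a < n" for a
  proof -
    have "mat_delete M a a = char_poly_matrix (mat_delete A a a)"
      using A that by (intro eq_matI) (auto simp: M_def char_poly_matrix_def mat_delete_def)
    then show ?thesis
      using M that by (simp add: B_def Determinant.adj_mat_def cofactor_def char_poly_def)
  qed
  ultimately show ?thesis
    using i j by simp
qed

section \<open>Schur complements over vertex lists\<close>

text \<open>Multiplying from the left by the block unitriangular matrix with
  \<open>- (Q * R)\<close> in the upper right corner clears \<open>Q\<close> and leaves the
  determinant unchanged; the result is block lower triangular.\<close>

lemma det_schur_complement:
  fixes P :: "'b :: field mat"
  assumes P: "P \<in> carrier_mat k k" and Q: "Q \<in> carrier_mat k m" and S: "S \<in> carrier_mat m k"
    and N: "N \<in> carrier_mat m m" and R: "R \<in> carrier_mat m m" and RN: "R * N = 1\<^sub>m m"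
  shows "det (four_block_mat P Q S N) = det N * det (P - Q * R * S)"
proof -
  let ?L = "four_block_mat (1\<^sub>m k) (- (Q * R)) (0\<^sub>m m k) (1\<^sub>m m)"
  have QR: "Q * R \<in> carrier_mat k m"
    using Q R by simp
  have carr: "?L \<in> carrier_mat (k + m) (k + m)" "four_block_mat P Q S N \<in> carrier_mat (k + m) (k + m)"
    using P Q S N R by (auto intro!: four_block_carrier_mat)
  have "- (Q * R) * N = - Q"
    using Q R N RN QR by (simp add: assoc_mult_mat[of _ k m _ m _ m] uminus_mult_left_mat[of "Q * R" N])
  moreover have "- (Q * R) * S = - (Q * R * S)"
    using QR S by (intro uminus_mult_left_mat) auto
  ultimately have "?L * four_block_mat P Q S N =
      four_block_mat (P - Q * R * S) (0\<^sub>m k m) S N"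
    using P Q S N R QR
    by (subst mult_four_block_mat[of _ k k _ m _ m _ _ k _ m])
      (auto simp: add_uminus_minus_mat[of _ k k] left_add_zero_mat[of _ m] minus_r_inv_mat[of Q k m])
  then have "det ?L * det (four_block_mat P Q S N) = det (P - Q * R * S) * det N"
    using P Q S N R carr
    by (subst det_mult[symmetric, of _ "k + m"])
       (auto intro!: det_four_block_mat_upper_right_zero[of _ k _ m] minus_carrier_mat)
  moreover have "det ?L = 1"
    using QR by (subst det_four_block_mat_lower_left_zero[of _ k _ m]) auto
  ultimately show ?thesis
    by simp
qed

text \<open>The bilinear form g^T R h, with functions on vertices read as vectors along
  \<open>xs\<close>. The sums are nested as in an entry of \<open>Q * R * S\<close>.\<close>

definition bil :: "'a list \<Rightarrow> 'b :: field mat \<Rightarrow> ('a \<Rightarrow> 'b) \<Rightarrow> ('a \<Rightarrow> 'b) \<Rightarrow> 'b" where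
  "bil xs R g h = (\<Sum>j<length xs. (\<Sum>i<length xs. g (xs ! i) * R $$ (i, j)) * h (xs ! j))"

lemma bil_cong:
  "(\<And>x. x \<in> set xs \<Longrightarrow> g x = g' x) \<Longrightarrow> (\<And>x. x \<in> set xs \<Longrightarrow> h x = h' x) \<Longrightarrow> bil xs R g h = bil xs R g' h'"
  by (simp add: bil_def)

lemma bil_0 [simp]: "bil xs R (\<lambda>_. 0) h = 0" "bil xs R g (\<lambda>_. 0) = 0"
  by (simp_all add: bil_def)

lemma bil_add:
  "bil xs R (\<lambda>x. g x + g' x) h = bil xs R g h + bil xs R g' h"
  "bil xs R g (\<lambda>x. h x + h' x) = bil xs R g h + bil xs R g h'"
  by (simp_all add: bil_def algebra_simps sum.distrib sum_distrib_left)

lemma bil_map: "bil (map k xs) R g h = bil xs R (\<lambda>x. g (k x)) (\<lambda>x. h (k x))"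
  by (simp add: bil_def)

lemma bil_commute:
  assumes R: "\<And>i j. i < length xs \<Longrightarrow> j < length xs \<Longrightarrow> R $$ (i, j) = R $$ (j, i)"
  shows "bil xs R g h = bil xs R h g"
proof -
  have "bil xs R g h = (\<Sum>j<length xs. \<Sum>i<length xs. g (xs ! i) * R $$ (i, j) * h (xs ! j))"
    by (simp add: bil_def sum_distrib_right)
  also have "\<dots> = (\<Sum>i<length xs. \<Sum>j<length xs. g (xs ! i) * R $$ (i, j) * h (xs ! j))"
    by (rule sum.swap)
  also have "\<dots> = bil xs R h g"
    unfolding bil_def sum_distrib_right by (intro sum.cong) (auto simp: R)
  finally show ?thesis .
qed

text \<open>Eliminates the vertices in \<open>xs\<close>. In the applications \<open>ys\<close>
  holds at most three vertices, so that an explicit small determinant remains.\<close>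

lemma det_enum_mat_append:
  fixes f :: "'a \<Rightarrow> 'a \<Rightarrow> 'b :: field"
  assumes R: "R \<in> carrier_mat (length xs) (length xs)" "R * enum_mat f xs = 1\<^sub>m (length xs)"
  shows "det (enum_mat f (ys @ xs)) =
    det (enum_mat f xs) * det (enum_mat (\<lambda>y y'. f y y' - bil xs R (f y) (\<lambda>x. f x y')) ys)"
proof -
  let ?k = "length ys" and ?m = "length xs"
  let ?Q = "mat ?k ?m (\<lambda>(i, j). f (ys ! i) (xs ! j))" and ?S = "mat ?m ?k (\<lambda>(i, j). f (xs ! i) (ys ! j))"
  have "enum_mat f (ys @ xs) = four_block_mat (enum_mat f ys) ?Q ?S (enum_mat f xs)"
    by (intro eq_matI) (auto simp: nth_append)
  also have "det \<dots> = det (enum_mat f xs) * det (enum_mat f ys - ?Q * R * ?S)"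
    by (rule det_schur_complement) (use R in auto)
  also have "enum_mat f ys - ?Q * R * ?S = enum_mat (\<lambda>y y'. f y y' - bil xs R (f y) (\<lambda>x. f x y')) ys"
  proof (rule eq_matI)
    fix i j
    assume "i < dim_row (enum_mat (\<lambda>y y'. f y y' - bil xs R (f y) (\<lambda>x. f x y')) ys)"
      "j < dim_col (enum_mat (\<lambda>y y'. f y y' - bil xs R (f y) (\<lambda>x. f x y')) ys)"
    then show "(enum_mat f ys - ?Q * R * ?S) $$ (i, j) =
        enum_mat (\<lambda>y y'. f y y' - bil xs R (f y) (\<lambda>x. f x y')) ys $$ (i, j)"
      using R(1) by (auto simp: scalar_prod_def atLeast0LessThan bil_def)
  qed (use R in auto)
  finally show ?thesis .
qed

lemma det_enum_mat_1: "det (enum_mat f [a]) = f a a"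
  by (subst det_single) auto

lemma det_2:
  fixes A :: "'b :: comm_ring_1 mat"
  assumes "A \<in> carrier_mat 2 2"
  shows "det A = A $$ (0, 0) * A $$ (1, 1) - A $$ (0, 1) * A $$ (1, 0)"
  using assms
  by (subst laplace_expansion_column[of _ 2 0])
     (auto simp: cofactor_def numeral_2_eq_2 det_single mat_delete_def)

lemma det_enum_mat_2:
  fixes f :: "'a \<Rightarrow> 'a \<Rightarrow> 'b :: comm_ring_1"
  shows "det (enum_mat f [a, b]) = f a a * f b b - f a b * f b a"
  by (subst det_2) auto

lemma det_enum_mat_3:
  fixes f :: "'a \<Rightarrow> 'a \<Rightarrow> 'b :: comm_ring_1"
  shows "det (enum_mat f [a, b, c]) =
      f a a * (f b b * f c c - f b c * f c b) - f a b * (f b a * f c c - f b c * f c a)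
      + f a c * (f b a * f c b - f b b * f c a)"
proof -
  have minor: "det (mat_delete (enum_mat f [a, b, c]) i j) =
      (let M = mat_delete (enum_mat f [a, b, c]) i j in M $$ (0, 0) * M $$ (1, 1) - M $$ (0, 1) * M $$ (1, 0))" for i j
    unfolding Let_def by (rule det_2) (simp add: mat_delete_def numeral_2_eq_2)
  have "det (enum_mat f [a, b, c]) =
      (\<Sum>i<3. enum_mat f [a, b, c] $$ (i, 0) * cofactor (enum_mat f [a, b, c]) i 0)"
    by (rule laplace_expansion_column) (simp_all add: carrier_matI)
  then show ?thesis
    unfolding cofactor_def minor
    by (simp add: numeral_3_eq_3 mat_delete_def algebra_simps)
qed

text \<open>Transposing \<open>R * N = I\<close> for symmetric \<open>N\<close> shows that the
  transpose of \<open>R\<close> also inverts \<open>N\<close>, so it equals \<open>R\<close>.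
  Symmetry of \<open>R\<close> makes \<open>bil\<close> symmetric.\<close>

lemma inverse_enum_mat_symmetric:
  fixes f :: "'a \<Rightarrow> 'a \<Rightarrow> 'b :: field"
  assumes "\<And>x y. f x y = f y x" and "det (enum_mat f xs) \<noteq> 0"
  obtains R where "R \<in> carrier_mat (length xs) (length xs)" "R * enum_mat f xs = 1\<^sub>m (length xs)"
    "\<And>i j. i < length xs \<Longrightarrow> j < length xs \<Longrightarrow> R $$ (i, j) = R $$ (j, i)"
proof -
  let ?N = "enum_mat f xs" and ?n = "length xs"
  have N: "?N \<in> carrier_mat ?n ?n" by simp
  obtain R where R: "R \<in> carrier_mat ?n ?n" "R * ?N = 1\<^sub>m ?n" "?N * R = 1\<^sub>m ?n"
    using det_non_zero_imp_unit[OF N assms(2), of "()"] by (auto simp: Units_def ring_mat_def)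
  have "transpose_mat ?N = ?N"
    using assms(1) by (intro eq_matI) auto
  then have "?N * transpose_mat R = 1\<^sub>m ?n"
    using transpose_mult[OF R(1) N] R(2) by simp
  then have "R * (?N * transpose_mat R) = R"
    using R(1) by simp
  then have "transpose_mat R = R"
    using R N by (subst (asm) assoc_mult_mat[symmetric, of _ ?n ?n _ ?n _ ?n]) auto
  then have "R $$ (i, j) = R $$ (j, i)" if "i < ?n" "j < ?n" for i j
    using that R(1) by (metis carrier_matD index_transpose_mat(1))
  with R show thesis using that by blast
qed

section \<open>Roots and degrees of monic polynomials\<close>

text \<open>Over the complex numbers a polynomial is its leading coefficient times the product of
  its linear factors.\<close>

lemma proots_monic_eq_iff:
  fixes p q :: "complex poly"
  assumes "monic p" "monic q"
  shows "proots p = proots q \<longleftrightarrow> p = q"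
proof
  assume "proots p = proots q"
  then show "p = q"
    using arg_cong2[OF complex_poly_decompose_multiset[of p] complex_poly_decompose_multiset[of q], of "(=)"]
    by (simp only: assms refl)
qed simp

text \<open>Both \<open>D * D\<close> and \<open>E * \<phi>\<close> are monic of degree
  \<open>2 * m + 2\<close>, so their leading terms cancel in \<open>T * T\<close>.\<close>

lemma degree_sq_minus_mult_less:
  fixes \<phi> D E :: "'a :: idom poly"
  assumes "monic \<phi>" "monic D" "monic E"
    and "degree \<phi> = Suc (Suc m)" "degree D = Suc m" "degree E = m"
    and "E * \<phi> = D * D - T * T"
  shows "degree T \<le> m"
proof -
  have nz: "\<phi> \<noteq> 0" "D \<noteq> 0" "E \<noteq> 0"
    using assms by auto
  have deg: "degree (D * D) = 2 * m + 2" "degree (E * \<phi>) = 2 * m + 2"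
    using assms(4-6) nz by (simp_all add: degree_mult_eq)
  have lead: "coeff (D * D) (2 * m + 2) = 1" "coeff (E * \<phi>) (2 * m + 2) = 1"
    using lead_coeff_mult[of D D] lead_coeff_mult[of E \<phi>] assms(1-3) unfolding deg by simp_all
  have TT: "T * T = D * D - E * \<phi>"
    using assms by simp
  have "degree (T * T) \<le> 2 * m + 2"
    unfolding TT using deg by (intro degree_diff_le) simp_all
  moreover have "coeff (T * T) (2 * m + 2) = 0"
    unfolding TT using lead by simp
  ultimately have "T * T = 0 \<or> degree (T * T) < 2 * m + 2"
    using eq_zero_or_degree_less by blast
  then show ?thesis
    by (cases "T = 0") (auto simp: degree_mult_eq)
qed

text \<open>The second factor cannot vanish: \<open>\<phi>\<close> has degree \<open>m + 2\<close>,
  while \<open>L * (T + T')\<close> has degree at most \<open>m + 1\<close>.\<close>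

lemma poly_quadratic_cancel:
  fixes \<phi> T T' L :: "complex poly"
  assumes "degree T \<le> m" "degree T' \<le> m" "degree L \<le> 1" "degree \<phi> = Suc (Suc m)" "c \<noteq> 0"
    and "(T - T') * (Polynomial.smult c \<phi> - L * (T + T')) = 0"
  shows "T = T'"
proof (rule ccontr)
  assume "T \<noteq> T'"
  with assms have "Polynomial.smult c \<phi> = L * (T + T')" by simp
  then have "degree (Polynomial.smult c \<phi>) \<le> 1 + m"
    using degree_mult_le[of L "T + T'"] degree_add_le[OF assms(1,2)] assms(3) by simp
  with assms show False by simp
qed

section \<open>Characteristic polynomials of induced subgraphs\<close>

text \<open>Keeping the entries of \<open>G\<close> and shrinking only the index set yields the
  subgraph induced on \<open>V\<close>.\<close>

definition chi :: "'a pair_pre_digraph \<Rightarrow> 'a set \<Rightarrow> complex poly" where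
  "chi G V = char_poly (adj_mat \<lparr>psverts = V, mult = adj_entry G\<rparr>)"

lemma chi_enum:
  "distinct xs \<Longrightarrow> chi G (set xs) = char_poly (enum_mat (\<lambda>x y. of_nat (adj_entry G x y)) xs)"
  unfolding chi_def by (subst char_poly_adj_mat_conv_enum_mat) simp_all

lemma monic_char_poly_adj_mat: "monic (char_poly (adj_mat H))"
proof -
  have "adj_mat H \<in> carrier_mat (dim_row (adj_mat H)) (dim_row (adj_mat H))"
    by (simp add: adj_mat_def Let_def)
  from degree_monic_char_poly[OF this] show ?thesis by (elim conjE) (simp only:)
qed

lemma sp_eq_iff: "sp H = sp H' \<longleftrightarrow> char_poly (adj_mat H) = char_poly (adj_mat H')"
  by (simp add: sp_def proots_monic_eq_iff monic_char_poly_adj_mat)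

lemma chi_monic:
  assumes V: "finite V"
  shows "monic (chi G V)" "degree (chi G V) = card V"
proof -
  show "monic (chi G V)" by (simp add: chi_def monic_char_poly_adj_mat)
  obtain xs where "distinct xs" "set xs = V" using finite_distinct_list[OF V] by blast
  then show "degree (chi G V) = card V"
    using chi_enum[of xs G] degree_monic_char_poly[OF enum_mat_carrier[of "\<lambda>x y. of_nat (adj_entry G x y) :: complex" xs]]
      distinct_card[of xs] by simp
qed

lemma poly_char_poly_adj_mat:
  assumes "distinct xs" and "psverts H = set xs"
  shows "poly (char_poly (adj_mat H)) t =
    det (enum_mat (\<lambda>x y. (if x = y then t else 0) - of_nat (mult H x y)) xs)"
  by (simp add: char_poly_adj_mat_conv_enum_mat[OF assms] poly_char_poly_enum_mat[OF assms(1)])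

text \<open>The one place where walk-regularity enters: \<open>char_poly_mat_delete_cong\<close> is
  carried over from positions in the enumeration to vertices.\<close>

lemma walk_regular_chi:
  assumes fin: "finite (pverts G)" and wr: "walk_regular G" and u: "u \<in> pverts G" and w: "w \<in> pverts G"
  shows "chi G (pverts G - {u}) = chi G (pverts G - {w})"
proof -
  let ?xs = "vertex_enum (pverts G)" and ?a = "\<lambda>x y. of_nat (adj_entry G x y) :: complex"
  note xs = vertex_enum[OF fin]
  have A: "adj_mat (pseudograph_of G) = enum_mat ?a ?xs"
    by (simp add: adj_mat_def pseudograph_of_def enum_mat_def Let_def)
  have del: "chi G (pverts G - {?xs ! i}) = char_poly (mat_delete (enum_mat ?a ?xs) i i)"
    if i: "i < length ?xs" for i
  proof -
    have split: "take i ?xs @ ?xs ! i # drop (Suc i) ?xs = ?xs"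
      using id_take_nth_drop[OF i] by (rule sym)
    have "distinct (take i ?xs @ ?xs ! i # drop (Suc i) ?xs)"
      "pverts G = set (take i ?xs @ ?xs ! i # drop (Suc i) ?xs)"
      unfolding split by (rule xs(1), rule xs(2)[symmetric])
    then have "distinct (take i ?xs @ drop (Suc i) ?xs)"
      "pverts G - {?xs ! i} = set (take i ?xs @ drop (Suc i) ?xs)"
      by auto
    then show ?thesis
      using chi_enum[of "take i ?xs @ drop (Suc i) ?xs" G] by (simp add: mat_delete_enum_mat[OF i])
  qed
  have "u \<in> set ?xs" "w \<in> set ?xs"
    using u w xs(2) by simp_all
  then obtain i j where ij: "i < length ?xs" "?xs ! i = u" "j < length ?xs" "?xs ! j = w"
    unfolding in_set_conv_nth by blast
  have diag: "(enum_mat ?a ?xs ^\<^sub>m l) $$ (i, i) = (enum_mat ?a ?xs ^\<^sub>m l) $$ (j, j)"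
    if "i < length ?xs" "j < length ?xs" for l i j
    using wr that unfolding walk_regular_def A Let_def enum_mat_dim by blast
  have "char_poly (mat_delete (enum_mat ?a ?xs) i i) = char_poly (mat_delete (enum_mat ?a ?xs) j j)"
    by (rule char_poly_mat_delete_cong[OF enum_mat_carrier diag ij(1,3)])
  then show ?thesis
    using del[of i] del[of j] ij by simp
qed

section \<open>The three modified graphs in terms of one pair of vertices\<close>

text \<open>At a point \<open>t\<close> with \<open>e = E(t)\<close> nonzero, let the Schur
  complement of \<open>t I - A\<close> on \<open>u\<close>, \<open>v\<close> have diagonal
  \<open>\<alpha>\<close>, \<open>\<delta>\<close> and off-diagonal entry \<open>\<gamma>\<close>.
  All polynomials involved take values that are \<open>e\<close> times expressions in these entries,
  and \<open>T(t) = - e \<gamma>\<close>.\<close>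

lemma pair_identities:
  fixes G :: "'a pair_pre_digraph"
  assumes G: "pair_graph G" and uv: "u \<in> pverts G" "v \<in> pverts G" "u \<noteq> v"
  defines "s \<equiv> (if (u, v) \<in> parcs G then - 1 else 1)" and "a \<equiv> of_nat (adj_entry G u v)"
    and "\<phi> \<equiv> chi G (pverts G)" and "E \<equiv> chi G (pverts G - {u, v})"
    and "D\<^sub>u \<equiv> chi G (pverts G - {u})" and "D\<^sub>v \<equiv> chi G (pverts G - {v})"
  obtains T where "E * \<phi> = D\<^sub>u * D\<^sub>v - T * T"
    and "char_poly (adj_mat (pseudograph_of (flip_edge G u v))) = \<phi> - Polynomial.smult (2 * s) T - E"
    and "char_poly (adj_mat (amalgamate G u v)) = D\<^sub>u + D\<^sub>v - 2 * T - [:-a, 1:] * E"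
    and "char_poly (adj_mat (pseudograph_of (add_common_neighbor G u v))) = [:0, 1:] * \<phi> - D\<^sub>u - D\<^sub>v - 2 * T"
proof -
  interpret pair_graph G by (rule G)
  have adj_sym: "adj_entry G x y = adj_entry G y x" for x y
    using pair_sym_arcs by (auto simp: adj_entry_def symmetric_def sym_def)
  have adj_irrefl: "adj_entry G x x = 0" for x
    using pair_no_loops[of "(x, x)"] by (auto simp: adj_entry_def)
  define \<chi>a where "\<chi>a = char_poly (adj_mat (pseudograph_of (flip_edge G u v)))"
  define \<chi>b where "\<chi>b = char_poly (adj_mat (amalgamate G u v))"
  define \<chi>c where "\<chi>c = char_poly (adj_mat (pseudograph_of (add_common_neighbor G u v)))"
  \<comment> \<open>Solving the last identity for \<open>T\<close> guarantees a polynomial; its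
    meaning as a cofactor is recovered pointwise below.\<close>
  define T where "T = Polynomial.smult (1/2) ([:0, 1:] * \<phi> - D\<^sub>u - D\<^sub>v - \<chi>c)"
  obtain xs where xs: "distinct xs" "set xs = pverts G - {u, v}"
    using finite_distinct_list[of "pverts G - {u, v}"] pair_finite_verts by auto
  have E0: "E \<noteq> 0"
    using chi_monic(1)[of "pverts G - {u, v}" G] pair_finite_verts by (auto simp: E_def)
  \<comment> \<open>Only where \<open>E\<close> does not vanish is the block on \<open>xs\<close> invertible.\<close>
  have eqI_off_roots: "p = q" if *: "\<And>t. poly E t \<noteq> 0 \<Longrightarrow> poly p t = poly q t" for p q
  proof -
    have "poly (E * (p - q)) t = 0" for t
      using *[of t] by auto
    then have "E * (p - q) = 0"
      using poly_all_0_iff_0 by blast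
    then show ?thesis using E0 by simp
  qed
  have main: "poly (E * \<phi>) t = poly (D\<^sub>u * D\<^sub>v - T * T) t \<and>
      poly \<chi>a t = poly (\<phi> - Polynomial.smult (2 * s) T - E) t \<and>
      poly \<chi>b t = poly (D\<^sub>u + D\<^sub>v - 2 * T - [:-a, 1:] * E) t"
    if Et: "poly E t \<noteq> 0" for t
  proof -
    define f where "f x y = (if x = y then t else 0) - of_nat (adj_entry G x y)" for x y
    have poly_chi: "poly (chi G (set ys)) t = det (enum_mat f ys)" if "distinct ys" for ys
      unfolding chi_def f_def by (subst poly_char_poly_adj_mat[OF that]) simp_all
    have f_sym: "f x y = f y x" for x y
      by (simp add: f_def adj_sym)
    define e where "e = det (enum_mat f xs)"
    have e: "poly E t = e"
      using poly_chi[OF xs(1)] by (simp add: E_def e_def xs(2))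
    obtain R where R: "R \<in> carrier_mat (length xs) (length xs)" "R * enum_mat f xs = 1\<^sub>m (length xs)"
      "\<And>i j. i < length xs \<Longrightarrow> j < length xs \<Longrightarrow> R $$ (i, j) = R $$ (j, i)"
      using inverse_enum_mat_symmetric[of f xs] f_sym Et[unfolded e e_def] by blast
    note schur = det_enum_mat_append[OF R(1,2)]
    define \<alpha> \<delta> \<gamma> where "\<alpha> = f u u - bil xs R (f u) (f u)" and "\<delta> = f v v - bil xs R (f v) (f v)"
      and "\<gamma> = f u v - bil xs R (f u) (f v)"
    have f_col: "(\<lambda>x. f x y) = f y" for y
      using f_sym by blast
    have bil_vu: "bil xs R (f v) (f u) = bil xs R (f u) (f v)"
      by (rule bil_commute) (rule R(3))
    have fuv: "f u u = t" "f v v = t" "f u v = - a" "f v u = - a"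
      using uv adj_sym[of v u] by (simp_all add: f_def a_def adj_irrefl)
    \<comment> \<open>Deleting \<open>u\<close> leaves \<open>v\<close>, hence
      \<open>\<delta>\<close> here and \<open>\<alpha>\<close> for \<open>D\<^sub>v\<close>.\<close>
    have Du: "poly D\<^sub>u t = e * \<delta>"
    proof -
      have "D\<^sub>u = chi G (set ([v] @ xs))"
        unfolding D\<^sub>u_def using xs(2) uv by (intro arg_cong[of _ _ "chi G"]) auto
      then show ?thesis
        using poly_chi[of "[v] @ xs"] schur[of "[v]"] xs
        by (simp add: det_enum_mat_1 f_col \<delta>_def e_def)
    qed
    have Dv: "poly D\<^sub>v t = e * \<alpha>"
    proof -
      have "D\<^sub>v = chi G (set ([u] @ xs))"
        unfolding D\<^sub>v_def using xs(2) uv by (intro arg_cong[of _ _ "chi G"]) auto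
      then show ?thesis
        using poly_chi[of "[u] @ xs"] schur[of "[u]"] xs
        by (simp add: det_enum_mat_1 f_col \<alpha>_def e_def)
    qed
    have phi: "poly \<phi> t = e * (\<alpha> * \<delta> - \<gamma> * \<gamma>)"
    proof -
      have "\<phi> = chi G (set ([u, v] @ xs))"
        unfolding \<phi>_def using xs(2) uv by (intro arg_cong[of _ _ "chi G"]) auto
      then show ?thesis
        using poly_chi[of "[u, v] @ xs"] schur[of "[u, v]"] xs uv
        by (simp add: det_enum_mat_2 f_col \<alpha>_def \<delta>_def \<gamma>_def e_def bil_vu f_sym[of v u])
    qed
    \<comment> \<open>Flipping changes \<open>t I - A\<close> only at the two off-diagonal positions
      of the pair, by \<open>- s\<close>; the correction through \<open>xs\<close> is unaffected, so
      \<open>\<gamma>\<close> becomes \<open>\<gamma> - s\<close>.\<close>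
    have flip: "poly \<chi>a t = e * (\<alpha> * \<delta> - (\<gamma> - s) * (\<gamma> - s))"
    proof -
      define g where "g x y = (if x = y then t else 0) - of_nat (adj_entry (flip_edge G u v) x y)" for x y
      have g_f: "g x y = f x y" if "{x, y} \<noteq> {u, v}" for x y
        using that by (auto simp: g_def f_def flip_edge_def adj_entry_def)
      have g_uv: "g u v = f u v - s" "g v u = f u v - s"
        using uv adj_sym[of u v] by (auto simp: g_def f_def flip_edge_def adj_entry_def s_def split: if_splits)
      have g_xs: "g x y = f x y" "g y x = f x y" if "y \<in> set xs" for x y
        using that xs(2) g_f[of x y] g_f[of y x] f_sym[of y x] by (auto simp: doubleton_eq_iff)
      have N: "enum_mat g xs = enum_mat f xs"
        by (intro enum_mat_cong g_xs)
      have bil: "bil xs R (g x) (\<lambda>z. g z y) = bil xs R (f x) (f y)" for x y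
        by (intro bil_cong) (simp_all add: g_xs)
      have "poly \<chi>a t = det (enum_mat g ([u, v] @ xs))"
        unfolding \<chi>a_def g_def using xs uv
        by (subst poly_char_poly_adj_mat) (auto simp: pseudograph_of_def flip_edge_def)
      also have "\<dots> = e * (\<alpha> * \<delta> - (\<gamma> - s) * (\<gamma> - s))"
        using det_enum_mat_append[OF R(1), of g "[u, v]"] R(2) uv
        by (simp add: N bil det_enum_mat_2 \<alpha>_def \<delta>_def \<gamma>_def e_def bil_vu g_uv g_f doubleton_eq_iff)
          (simp add: algebra_simps)
      finally show ?thesis .
    qed
    \<comment> \<open>On \<open>xs\<close> the row of the new vertex is the sum of the rows of
      \<open>u\<close> and \<open>v\<close>, so its correction expands bilinearly. Only its diagonal
      entry \<open>t - a\<close> differs from the full sum over the block, which is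
      \<open>2 * t - 2 * a\<close>.\<close>
    have amal: "poly \<chi>b t = e * (\<alpha> + \<delta> + 2 * \<gamma> - (t - a))"
    proof -
      define g where "g x y = (if x = y then t else 0) - of_nat (amalg_mult G u v x y)" for x y
      have g_None: "g None None = t - a" "x \<noteq> u \<Longrightarrow> x \<noteq> v \<Longrightarrow> g None (Some x) = f u x + f v x"
        "x \<noteq> u \<Longrightarrow> x \<noteq> v \<Longrightarrow> g (Some x) None = f u x + f v x" for x
        by (auto simp: g_def f_def a_def)
      have g_Some: "(\<lambda>x y. g (Some x) (Some y)) = f"
        by (auto simp: g_def f_def fun_eq_iff)
      have N: "enum_mat g (map Some xs) = enum_mat f xs"
        by (simp add: enum_mat_map g_Some)
      have "bil (map Some xs) R (g None) (\<lambda>z. g z None) =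
          bil xs R (\<lambda>x. f u x + f v x) (\<lambda>x. f u x + f v x)"
        unfolding bil_map using xs(2) by (intro bil_cong) (auto simp: g_None)
      then have bil: "bil (map Some xs) R (g None) (\<lambda>z. g z None) =
          bil xs R (f u) (f u) + bil xs R (f v) (f v) + 2 * bil xs R (f u) (f v)"
        by (simp add: bil_add bil_vu)
      have "poly \<chi>b t = det (enum_mat g ([None] @ map Some xs))"
        unfolding \<chi>b_def g_def using xs uv
        by (subst poly_char_poly_adj_mat) (auto simp: amalgamate_def distinct_map)
      also have "\<dots> = e * (\<alpha> + \<delta> + 2 * \<gamma> - (t - a))"
        using det_enum_mat_append[of R "map Some xs" g "[None]"] R(1,2)
        by (simp add: N bil det_enum_mat_1 \<alpha>_def \<delta>_def \<gamma>_def e_def g_None fuv)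
      finally show ?thesis .
    qed
    \<comment> \<open>The new vertex has no neighbor in \<open>xs\<close>, so its row receives no
      correction. What remains is the determinant with rows (t, -1, -1), (-1, \<alpha>, \<gamma>),
      (-1, \<gamma>, \<delta>).\<close>
    have addc: "poly \<chi>c t = e * (t * (\<alpha> * \<delta> - \<gamma> * \<gamma>) - \<alpha> - \<delta> + 2 * \<gamma>)"
    proof -
      define g where "g x y = (if x = y then t else 0) - of_nat (adj_entry (add_common_neighbor G u v) x y)" for x y
      have g_None: "g None None = t" "g None (Some x) = (if x = u \<or> x = v then - 1 else 0)"
        "g (Some x) None = (if x = u \<or> x = v then - 1 else 0)" for x
        by (auto simp: g_def add_common_neighbor_def adj_entry_def)
      have g_Some: "g (Some x) (Some y) = f x y" for x y
        by (auto simp: g_def f_def add_common_neighbor_def adj_entry_def)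
      have N: "enum_mat g (map Some xs) = enum_mat f xs"
        by (simp add: enum_mat_map g_Some)
      have "bil (map Some xs) R (g None) h = bil xs R (\<lambda>_. 0) (\<lambda>x. h (Some x))"
        "bil (map Some xs) R h (\<lambda>z. g z None) = bil xs R (\<lambda>x. h (Some x)) (\<lambda>_. 0)" for h
        unfolding bil_map using xs(2) by (intro bil_cong; force simp: g_None)+
      then have bil_None: "bil (map Some xs) R (g None) h = 0" "bil (map Some xs) R h (\<lambda>z. g z None) = 0" for h
        by simp_all
      have bil: "bil (map Some xs) R (g (Some x)) (\<lambda>z. g z (Some y)) = bil xs R (f x) (f y)" for x y
        by (simp add: bil_map g_Some f_col)
      have "poly \<chi>c t = det (enum_mat g ([None, Some u, Some v] @ map Some xs))"
        unfolding \<chi>c_def g_def using xs uv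
        by (subst poly_char_poly_adj_mat) (auto simp: pseudograph_of_def add_common_neighbor_def distinct_map)
      also have "\<dots> = e * (t * (\<alpha> * \<delta> - \<gamma> * \<gamma>) - \<alpha> - \<delta> + 2 * \<gamma>)"
        using det_enum_mat_append[of R "map Some xs" g "[None, Some u, Some v]"] R(1,2)
        by (simp add: N bil_None bil det_enum_mat_3 \<alpha>_def \<delta>_def \<gamma>_def e_def g_None g_Some bil_vu f_sym[of v u])
      finally show ?thesis .
    qed
    have T: "poly T t = - e * \<gamma>"
      by (simp add: T_def phi Du Dv addc) (simp add: algebra_simps)
    \<comment> \<open>Since \<open>s\<close> is a sign, the constant term of the square contributes
      exactly \<open>- E\<close>.\<close>
    have "s * s = 1" by (simp add: s_def)
    then have "(\<gamma> - s) * (\<gamma> - s) = \<gamma> * \<gamma> - 2 * s * \<gamma> + 1"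
      by (simp add: algebra_simps)
    note flip = flip[unfolded this]
    show ?thesis
      by (intro conjI; simp add: T phi Du Dv flip amal e; simp add: algebra_simps)
  qed
  show thesis
  proof (rule that[of T])
    show "E * \<phi> = D\<^sub>u * D\<^sub>v - T * T" using main by (intro eqI_off_roots) blast
    show "char_poly (adj_mat (pseudograph_of (flip_edge G u v))) = \<phi> - Polynomial.smult (2 * s) T - E"
      unfolding \<chi>a_def[symmetric] using main by (intro eqI_off_roots) blast
    show "char_poly (adj_mat (amalgamate G u v)) = D\<^sub>u + D\<^sub>v - 2 * T - [:-a, 1:] * E"
      unfolding \<chi>b_def[symmetric] using main by (intro eqI_off_roots) blast
    show "char_poly (adj_mat (pseudograph_of (add_common_neighbor G u v))) = [:0, 1:] * \<phi> - D\<^sub>u - D\<^sub>v - 2 * T"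
      unfolding \<chi>c_def[symmetric] by (simp add: T_def numeral_poly)
  qed
qed

section \<open>Reduction of cospectrality to equality of cofactors\<close>

text \<open>Subtracting the relations for \<open>E\<close> and \<open>E'\<close> gives
  \<open>(E - E') * \<phi> = T' * T' - T * T\<close>, while each equality of characteristic
  polynomials ties \<open>E - E'\<close> linearly to \<open>T' - T\<close>. Conversely,
  \<open>T = T'\<close> forces \<open>E = E'\<close> because \<open>\<phi>\<close> is
  nonzero.\<close>

lemma quadratic_identities_eq_iff:
  fixes \<phi> D E E' T T' :: "complex poly"
  assumes monic: "monic \<phi>" "monic D" "monic E" "monic E'"
    and degree: "degree \<phi> = Suc (Suc m)" "degree D = Suc m" "degree E = m" "degree E' = m"
    and E: "E * \<phi> = D * D - T * T" and E': "E' * \<phi> = D * D - T' * T'" and s: "s \<noteq> 0"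
  shows "\<phi> - Polynomial.smult (2 * s) T - E = \<phi> - Polynomial.smult (2 * s) T' - E' \<longleftrightarrow> T = T'" (is ?a)
    and "D + D - 2 * T - [:- a, 1:] * E = D + D - 2 * T' - [:- a, 1:] * E' \<longleftrightarrow> T = T'" (is ?b)
proof -
  have \<phi>: "\<phi> \<noteq> 0" using monic by auto
  have T: "degree T \<le> m" "degree T' \<le> m"
    using degree_sq_minus_mult_less[OF monic(1-3) degree(1-3) E]
      degree_sq_minus_mult_less[OF monic(1,2,4) degree(1,2,4) E'] by simp_all
  have E_eq: "E = E'" if "T = T'"
  proof -
    have "E * \<phi> = E' * \<phi>" unfolding E E' that ..
    with \<phi> show ?thesis by simp
  qed
  note cancel = poly_quadratic_cancel[OF T _ degree(1)]
  have TT: "T' * T' - T * T = (E - E') * \<phi>"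
    using E E' by (simp add: left_diff_distrib)
  have factor: "(T - T') * (C - L * (T + T')) = 0" if "L * (T' * T' - T * T) = (T' - T) * C" for C L
    using that by (simp add: algebra_simps)
  have cancel_left: "y - y' = x' - x" if "d - x - y = d - x' - y'" for d x y x' y' :: "complex poly"
  proof -
    have "y - y' = (d - x - y') - (d - x - y)" by simp
    also have "\<dots> = x' - x" unfolding that by simp
    finally show ?thesis .
  qed
  show ?a
  proof
    assume "\<phi> - Polynomial.smult (2 * s) T - E = \<phi> - Polynomial.smult (2 * s) T' - E'"
    then have *: "E - E' = Polynomial.smult (2 * s) (T' - T)"
      unfolding smult_diff_right by (rule cancel_left)
    have "1 * (T' * T' - T * T) = (T' - T) * Polynomial.smult (2 * s) \<phi>"
      unfolding TT * by simp
    then have "(T - T') * (Polynomial.smult (2 * s) \<phi> - 1 * (T + T')) = 0"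
      by (rule factor)
    then show "T = T'"
      using s by (intro cancel[of 1 "2 * s"]) simp_all
  qed (simp add: E_eq)
  show ?b
  proof
    assume "D + D - 2 * T - [:- a, 1:] * E = D + D - 2 * T' - [:- a, 1:] * E'"
    then have *: "[:- a, 1:] * (E - E') = 2 * (T' - T)"
      unfolding right_diff_distrib by (rule cancel_left)
    \<comment> \<open>Here \<open>E - E'\<close> is only known after multiplication by
      \<open>x - a\<close>, so the difference of squares is multiplied by it as well; hence the
      linear factor \<open>L\<close> in \<open>poly_quadratic_cancel\<close>.\<close>
    have "[:- a, 1:] * (T' * T' - T * T) = 2 * (T' - T) * \<phi>"
      unfolding TT *[symmetric] by (rule mult.assoc[symmetric])
    also have "\<dots> = (T' - T) * Polynomial.smult 2 \<phi>"
      by (simp add: numeral_poly)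
    finally have "(T - T') * (Polynomial.smult 2 \<phi> - [:- a, 1:] * (T + T')) = 0"
      by (rule factor)
    then show "T = T'"
      by (intro cancel[of "[:- a, 1:]" 2]) simp_all
  qed (simp add: E_eq)
qed

theorem proposition4p3:
  fixes G :: "'a pair_pre_digraph" and u v w z :: 'a
  assumes "pair_graph G"
    and "Digraph_Component.connected (with_proj G)"
    and "walk_regular G"
    and "u \<in> pverts G" and "v \<in> pverts G" and "u \<noteq> v"
    and "w \<in> pverts G" and "z \<in> pverts G" and "w \<noteq> z"
    and "(u, v) \<in> parcs G \<longleftrightarrow> (w, z) \<in> parcs G"
  shows "(sp (pseudograph_of (flip_edge G u v)) = sp (pseudograph_of (flip_edge G w z))
            \<longleftrightarrow> sp (amalgamate G u v) = sp (amalgamate G w z))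
       \<and> (sp (amalgamate G u v) = sp (amalgamate G w z)
            \<longleftrightarrow> sp (pseudograph_of (add_common_neighbor G u v))
                = sp (pseudograph_of (add_common_neighbor G w z)))"
proof -
  interpret pair_graph G by fact
  define \<phi> D where "\<phi> = chi G (pverts G)" and "D = chi G (pverts G - {u})"
  define m where "m = card (pverts G) - 2"
  define s :: complex where "s = (if (u, v) \<in> parcs G then - 1 else 1)"
  define a :: complex where "a = of_nat (adj_entry G u v)"
  have D: "chi G (pverts G - {x}) = D" if "x \<in> pverts G" for x
    unfolding D_def using walk_regular_chi[OF pair_finite_verts] assms(3,4) that by blast
  \<comment> \<open>Equal adjacency of the two pairs makes the sign of the flip and the loop entry
    agree, so both pairs share the same coefficients.\<close>
  have s: "(if (w, z) \<in> parcs G then - 1 else 1) = s" and a: "of_nat (adj_entry G w z) = a"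
    using assms(10) by (simp_all add: s_def a_def adj_entry_def)
  \<comment> \<open>Two distinct vertices keep the natural subtraction in \<open>m\<close> from
    truncating.\<close>
  have "card {u, v} \<le> card (pverts G)"
    using assms(4,5) by (intro card_mono) auto
  then have card: "card (pverts G) = Suc (Suc m)"
    using assms(6) by (simp add: m_def)
  have chi: "monic \<phi>" "monic D"
    unfolding \<phi>_def D_def by (intro chi_monic(1) finite_Diff pair_finite_verts)+
  have deg: "degree \<phi> = Suc (Suc m)" "degree D = Suc m"
    unfolding \<phi>_def D_def using pair_finite_verts card assms(4) by (simp_all add: chi_monic(2))
  have chi_E: "monic (chi G (pverts G - {x, y}))" "degree (chi G (pverts G - {x, y})) = m"
    if "x \<in> pverts G" "y \<in> pverts G" "x \<noteq> y" for x y
  proof -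
    have "card (pverts G - {x, y}) = m"
      using that card pair_finite_verts by (simp add: card_Diff_subset)
    then show "monic (chi G (pverts G - {x, y}))" "degree (chi G (pverts G - {x, y})) = m"
      using chi_monic(1,2)[of "pverts G - {x, y}" G] pair_finite_verts by (simp_all only: finite_Diff)
  qed
  obtain T where T: "chi G (pverts G - {u, v}) * \<phi> = D * D - T * T"
    "char_poly (adj_mat (pseudograph_of (flip_edge G u v))) =
      \<phi> - Polynomial.smult (2 * s) T - chi G (pverts G - {u, v})"
    "char_poly (adj_mat (amalgamate G u v)) = D + D - 2 * T - [:- a, 1:] * chi G (pverts G - {u, v})"
    "char_poly (adj_mat (pseudograph_of (add_common_neighbor G u v))) = [:0, 1:] * \<phi> - D - D - 2 * T"
    by (rule pair_identities[OF assms(1,4-6), unfolded D[OF assms(4)] D[OF assms(5)],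
          folded \<phi>_def s_def a_def]) (rule that)
  obtain T' where T': "chi G (pverts G - {w, z}) * \<phi> = D * D - T' * T'"
    "char_poly (adj_mat (pseudograph_of (flip_edge G w z))) =
      \<phi> - Polynomial.smult (2 * s) T' - chi G (pverts G - {w, z})"
    "char_poly (adj_mat (amalgamate G w z)) = D + D - 2 * T' - [:- a, 1:] * chi G (pverts G - {w, z})"
    "char_poly (adj_mat (pseudograph_of (add_common_neighbor G w z))) = [:0, 1:] * \<phi> - D - D - 2 * T'"
    by (rule pair_identities[OF assms(1,7-9), unfolded D[OF assms(7)] D[OF assms(8)] s a,
          folded \<phi>_def]) (rule that)
  have "s \<noteq> 0" by (simp add: s_def)
  note iff = quadratic_identities_eq_iff[OF chi(1,2) chi_E(1)[OF assms(4-6)] chi_E(1)[OF assms(7-9)]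
      deg chi_E(2)[OF assms(4-6)] chi_E(2)[OF assms(7-9)] T(1) T'(1) this]
  \<comment> \<open>For the added common neighbor, \<open>T\<close> enters linearly and all other
    terms are common to both pairs.\<close>
  have "x - 2 * T = x - 2 * T' \<longleftrightarrow> T = T'" for x
    by simp
  then show ?thesis
    unfolding sp_eq_iff T(2-4) T'(2-4) iff by (simp only:)
qed

end
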